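(* Let $(X,p)$ and $(Y,d)$ be metric spaces with $(Y,d)$ separable, and let $F: X \Rightarrow Y$ be a (total) multi-valued function. (a) If $F(x)$ is a compact subset of $Y$ for every $x \in X$, then the set of points of continuity of $F$ is a $\Pi^0_2$ (i.e. $G_\delta$) subset of $X$. (b) If $Y$ is exhaustible by compact sets and $F(x)$ is a closed subset of $Y$ for every $x \in X$, then the set of points of continuity of $F$ is a $\Sigma^0_3$ subset of $X$.
   Context: A multi-valued function $F: X \Rightarrow Y$ assigns to each $x\in X$ a subset $F(x)\subseteq Y$; all multi-valued functions are assumed total, i.e. $F(x)\neq\emptyset$ for all $x$. $F$ is identified with its graph $\{(x,y): y\in F(x)\}\subseteq X\times Y$. $F$ is continuous at $x$ if there is some $y\in F(x)$ such that for every $\varepsilon>0$ there is $\delta>0$ such that for every $x'$ with $p(x,x')<\delta$ there is $y'\in F(x')$ with $d(y,y')<\varepsilon$. A topological space $Y$ is exhaustible by compact sets if there is a sequence $(K_n)_{n\in\omega}$ of compact subsets of $Y$ with each $K_n$ contained in the interior of $K_{n+1}$ and $Y=\bigcup_n K_n$. $\Sigma^0_n,\Pi^0_n$ denote the usual levels of the Borel hierarchy ($\Sigma^0_1$ = open, $\Pi^0_1$ = closed, $\Sigma^0_{n+1}$ = countable unions of complements of sets in $\bigcup_{k\le n}\Sigma^0_k$, $\Pi^0_n$ = complements of $\Sigma^0_n$ sets). *)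

theory Defs
  imports "HOL-Analysis.Analysis"
begin

definition multifun :: "'a set \<Rightarrow> 'b set \<Rightarrow> ('a \<Rightarrow> 'b set) \<Rightarrow> bool" where
  "multifun X Y F \<longleftrightarrow> (\<forall>x\<in>X. F x \<subseteq> Y \<and> F x \<noteq> {})"

definition multifun_cont_at ::
  "'a set \<Rightarrow> ('a \<Rightarrow> 'a \<Rightarrow> real) \<Rightarrow> ('b \<Rightarrow> 'b \<Rightarrow> real) \<Rightarrow> ('a \<Rightarrow> 'b set) \<Rightarrow> 'a \<Rightarrow> bool" where
  "multifun_cont_at X p d F x \<longleftrightarrow>
     (\<exists>y\<in>F x. \<forall>\<epsilon>>0. \<exists>\<delta>>0. \<forall>x'\<in>X. p x x' < \<delta> \<longrightarrow> (\<exists>y'\<in>F x'. d y y' < \<epsilon>))"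

definition continuity_points ::
  "'a set \<Rightarrow> ('a \<Rightarrow> 'a \<Rightarrow> real) \<Rightarrow> ('b \<Rightarrow> 'b \<Rightarrow> real) \<Rightarrow> ('a \<Rightarrow> 'b set) \<Rightarrow> 'a set" where
  "continuity_points X p d F = {x \<in> X. multifun_cont_at X p d F x}"

definition exhaustible_by_compacts :: "'a topology \<Rightarrow> bool" where
  "exhaustible_by_compacts T \<longleftrightarrow>
     (\<exists>K::nat \<Rightarrow> 'a set. (\<forall>n. compactin T (K n)) \<and> (\<forall>n. K n \<subseteq> T interior_of K (Suc n)) \<and>
        topspace T = (\<Union>n. K n))"

text \<open>
  The finite levels of the Borel hierarchy of a topological space. Levels start at 1, so
  level 0 is a dummy (the empty family).
\<close>

fun Borel_Sigma :: "'a topology \<Rightarrow> nat \<Rightarrow> 'a set set" where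
  "Borel_Sigma T 0 = {}"
| "Borel_Sigma T (Suc 0) = {U. openin T U}"
| "Borel_Sigma T (Suc (Suc n)) =
     {\<Union>\<A> |\<A>. countable \<A> \<and> (\<forall>A\<in>\<A>. \<exists>k\<in>{1..Suc n}. \<exists>B\<in>Borel_Sigma T k. A = topspace T - B)}"

definition Borel_Pi :: "'a topology \<Rightarrow> nat \<Rightarrow> 'a set set" where
  "Borel_Pi T n = {topspace T - A |A. A \<in> Borel_Sigma T n}"

lemma Borel_Sigma_2_iff_fsigma_in: "S \<in> Borel_Sigma T 2 \<longleftrightarrow> fsigma_in T S"
proof -
  have *: "(\<exists>k\<in>{1..Suc 0}. \<exists>B\<in>Borel_Sigma T k. A = topspace T - B) \<longleftrightarrow> closedin T A" for A
    by (auto simp: closedin_def double_diff intro!: exI[of _ "topspace T - A"])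
  show ?thesis
    unfolding numeral_2_eq_2 Borel_Sigma.simps(3) * fsigma_in_def union_of_def
    by (auto simp: subset_iff Collect_mem_eq)
qed

lemma Borel_Pi_2_iff_gdelta_in: "S \<in> Borel_Pi T 2 \<longleftrightarrow> gdelta_in T S"
proof -
  have "S \<in> Borel_Pi T 2 \<longleftrightarrow> (\<exists>A. fsigma_in T A \<and> S = topspace T - A)"
    by (auto simp: Borel_Pi_def Borel_Sigma_2_iff_fsigma_in)
  also have "\<dots> \<longleftrightarrow> gdelta_in T S"
    by (metis Diff_subset double_diff fsigma_in_gdelta_in fsigma_in_subset
        gdelta_in_fsigma_in gdelta_in_subset subset_refl)
  finally show ?thesis .
qed

end

(* A point x is a continuity point of F if and only if some z in F x is "near x" to every precision
   e, i.e. F x' meets the e-ball about z for all x' close to x. If the candidates z range over a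
   compact set F x \<inter> K, then the choice of z may depend on e: a cover of F x \<inter> K by balls reduces
   finitely many precisions to one. Conversely, if z is near x to precision e, then on a whole
   neighbourhood of x the values F x' contain a point near x' to precision 2e; hence the condition
   for e may be replaced by its interior, at the price of enlarging K so that it contains a ball
   about z. With K = Y this exhibits the continuity points as a G_delta set, and with the members
   K_n of an exhaustion it exhibits them as a countable union of G_delta sets. *)

theory Submission
  imports Defs
begin

definition near_value ::
  "'a set \<Rightarrow> ('a \<Rightarrow> 'a \<Rightarrow> real) \<Rightarrow> ('b \<Rightarrow> 'b \<Rightarrow> real) \<Rightarrow> ('a \<Rightarrow> 'b set) \<Rightarrow> real \<Rightarrow> 'b \<Rightarrow> 'a \<Rightarrow> bool" where
  "near_value X p d F \<epsilon> y x \<longleftrightarrow>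
     (\<exists>\<delta>>0. \<forall>x'\<in>X. p x x' < \<delta> \<longrightarrow> (\<exists>y'\<in>F x'. d y y' < \<epsilon>))"

definition near_set ::
  "'a set \<Rightarrow> ('a \<Rightarrow> 'a \<Rightarrow> real) \<Rightarrow> ('b \<Rightarrow> 'b \<Rightarrow> real) \<Rightarrow> ('a \<Rightarrow> 'b set) \<Rightarrow> 'b set \<Rightarrow> real \<Rightarrow> 'a set" where
  "near_set X p d F K \<epsilon> = {x \<in> X. \<exists>y\<in>F x \<inter> K. near_value X p d F \<epsilon> y x}"

lemma multifun_cont_at_iff_near_value:
  "multifun_cont_at X p d F x \<longleftrightarrow> (\<exists>y\<in>F x. \<forall>\<epsilon>>0. near_value X p d F \<epsilon> y x)"
  by (simp add: multifun_cont_at_def near_value_def)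

lemma near_value_mono:
  assumes "near_value X p d F \<epsilon> y x" "\<epsilon> \<le> \<epsilon>'"
  shows "near_value X p d F \<epsilon>' y x"
  using assms unfolding near_value_def by (meson less_le_trans)

text \<open>By the triangle inequality, a point within \<open>\<epsilon>\<close> of \<open>z\<close>
  is within \<open>d y z + \<epsilon>\<close> of \<open>y\<close>. This serves to pass to the centre
  of a covering ball, and from a value at one point to a value at a nearby point.\<close>

lemma near_value_shift:
  assumes "Metric_space Y d" "multifun X Y F" "y \<in> Y" "z \<in> Y"
    and near: "near_value X p d F \<epsilon> z x"
  shows "near_value X p d F (d y z + \<epsilon>) y x"
proof -
  interpret Y: Metric_space Y d by fact
  obtain \<delta> where "\<delta> > 0" and \<delta>: "\<And>x'. x' \<in> X \<Longrightarrow> p x x' < \<delta> \<Longrightarrow> \<exists>y'\<in>F x'. d z y' < \<epsilon>"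
    using near by (auto simp: near_value_def)
  have "\<exists>y'\<in>F x'. d y y' < d y z + \<epsilon>" if x': "x' \<in> X" "p x x' < \<delta>" for x'
  proof -
    obtain y' where "y' \<in> F x'" "d z y' < \<epsilon>"
      using \<delta>[OF x'] by blast
    moreover have "y' \<in> Y"
      using \<open>multifun X Y F\<close> \<open>x' \<in> X\<close> \<open>y' \<in> F x'\<close> by (auto simp: multifun_def)
    ultimately show ?thesis
      using Y.triangle[OF \<open>y \<in> Y\<close> \<open>z \<in> Y\<close>] by force
  qed
  with \<open>\<delta> > 0\<close> show ?thesis
    by (auto simp: near_value_def)
qed

text \<open>If each \<open>y\<close> in \<open>F x\<close> failed at its own precision
  \<open>e y\<close>, finitely many balls of radius \<open>e y / 2\<close> would cover
  \<open>F x \<inter> K\<close>, and a positive lower bound of these radii would be a precision at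
  which every candidate in \<open>F x \<inter> K\<close> fails.\<close>

lemma multifun_cont_at_if_near_set:
  assumes Y: "Metric_space Y d" and F: "multifun X Y F"
    and compact: "compactin (Metric_space.mtopology Y d) (F x \<inter> K)"
    and near: "\<And>\<epsilon>. \<epsilon> > 0 \<Longrightarrow> x \<in> near_set X p d F K \<epsilon>"
  shows "multifun_cont_at X p d F x"
proof (rule ccontr)
  interpret Y: Metric_space Y d by fact
  assume "\<not> multifun_cont_at X p d F x"
  then obtain e where e: "\<And>y. y \<in> F x \<Longrightarrow> e y > 0 \<and> \<not> near_value X p d F (e y) y x"
    unfolding multifun_cont_at_iff_near_value by metis
  \<comment> \<open>One half of \<open>e y\<close> bounds the distance from the centre to a covered
    point, the other half the precision at that point.\<close>
  let ?B = "\<lambda>y. Y.mball y (e y / 2)"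
  have sub: "F x \<inter> K \<subseteq> Y"
    using compactin_subset_topspace[OF compact] by simp
  have "y \<in> ?B y" if "y \<in> F x \<inter> K" for y
    using e[of y] sub that by auto
  then have "F x \<inter> K \<subseteq> \<Union>(?B ` (F x \<inter> K))"
    by blast
  moreover have "\<forall>U\<in>?B ` (F x \<inter> K). openin Y.mtopology U"
    by auto
  ultimately obtain \<F> where \<F>: "finite \<F>" "\<F> \<subseteq> ?B ` (F x \<inter> K)" and "F x \<inter> K \<subseteq> \<Union>\<F>"
    using compact unfolding compactin_def by meson
  then obtain T where T: "finite T" "T \<subseteq> F x \<inter> K" and cover: "F x \<inter> K \<subseteq> \<Union>(?B ` T)"
    using finite_subset_image[OF \<F>] by blast
  \<comment> \<open>The element 1 keeps the set nonempty when \<open>T\<close> is empty.\<close>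
  define \<epsilon> where "\<epsilon> = Min (insert 1 ((\<lambda>y. e y / 2) ` T))"
  have "\<epsilon> > 0"
    using T e by (auto simp: \<epsilon>_def)
  then obtain z where z: "z \<in> F x \<inter> K" "near_value X p d F \<epsilon> z x"
    using near unfolding near_set_def by blast
  then obtain y where y: "y \<in> T" "z \<in> ?B y"
    using cover by blast
  have "\<epsilon> \<le> e y / 2"
    unfolding \<epsilon>_def using T y by (intro Min_le) auto
  then have "d y z + \<epsilon> \<le> e y"
    using y by simp
  moreover have "near_value X p d F (d y z + \<epsilon>) y x"
    using Y F z y by (intro near_value_shift[where Y = Y]) auto
  ultimately have "near_value X p d F (e y) y x"
    by (rule near_value_mono[rotated])
  then show False
    using e y T by blast
qed

text \<open>The value \<open>y\<close> mediates between nearby points: for \<open>x'\<close> close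
  to \<open>x\<close>, both some \<open>z\<close> in \<open>F x'\<close> and the values of
  \<open>F\<close> around \<open>x'\<close> come close to \<open>y\<close>, hence to each
  other.\<close>

lemma interior_near_set_if_near_value:
  assumes X: "Metric_space X p" and Y: "Metric_space Y d" and F: "multifun X Y F"
    and "x \<in> X" "y \<in> F x"
    and near: "\<And>\<epsilon>. \<epsilon> > 0 \<Longrightarrow> near_value X p d F \<epsilon> y x"
    and "r > 0" and ball: "Metric_space.mball Y d y r \<subseteq> K" and "\<epsilon> > 0"
  shows "x \<in> Metric_space.mtopology X p interior_of near_set X p d F K \<epsilon>"
proof -
  interpret X: Metric_space X p by fact
  interpret Y: Metric_space Y d by fact
  have "y \<in> Y"
    using F \<open>x \<in> X\<close> \<open>y \<in> F x\<close> by (auto simp: multifun_def)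
  \<comment> \<open>The bound \<open>r\<close> forces \<open>z\<close> into \<open>K\<close>; the
    bound \<open>\<epsilon> / 2\<close> gives
    \<open>d z y + \<eta> \<le> \<epsilon>\<close>.\<close>
  define \<eta> where "\<eta> = min r (\<epsilon> / 2)"
  have "\<eta> > 0"
    using \<open>r > 0\<close> \<open>\<epsilon> > 0\<close> by (simp add: \<eta>_def)
  then obtain \<delta> where "\<delta> > 0"
    and \<delta>: "\<And>x'. x' \<in> X \<Longrightarrow> p x x' < \<delta> \<Longrightarrow> \<exists>y'\<in>F x'. d y y' < \<eta>"
    using near[of \<eta>] by (auto simp: near_value_def)
  have "X.mball x \<delta> \<subseteq> near_set X p d F K \<epsilon>"
  proof
    fix x' assume x': "x' \<in> X.mball x \<delta>"
    then obtain z where z: "z \<in> F x'" "d y z < \<eta>"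
      using \<delta> by auto
    have "z \<in> Y"
      using F x' z by (auto simp: multifun_def)
    have "z \<in> K"
      using ball z \<open>y \<in> Y\<close> \<open>z \<in> Y\<close> by (auto simp: \<eta>_def)
    \<comment> \<open>The smaller ball about \<open>x'\<close> inherits the approximation of
      \<open>y\<close> from the ball about \<open>x\<close>, even if \<open>y\<close> is not in
      \<open>F x'\<close>.\<close>
    obtain \<rho> where "\<rho> > 0" and \<rho>: "X.mball x' \<rho> \<subseteq> X.mball x \<delta>"
      using x' X.openin_mball[of x \<delta>] by (auto simp: X.openin_mtopology)
    have "near_value X p d F \<eta> y x'"
      unfolding near_value_def using \<open>\<rho> > 0\<close> \<rho> \<delta> x' by (intro exI[of _ \<rho>]) auto
    then have "near_value X p d F (d z y + \<eta>) z x'"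
      using Y F \<open>y \<in> Y\<close> \<open>z \<in> Y\<close> by (intro near_value_shift)
    moreover have "d z y + \<eta> \<le> \<epsilon>"
      using z Y.commute[of z y] unfolding \<eta>_def by linarith
    ultimately have "near_value X p d F \<epsilon> z x'"
      by (rule near_value_mono)
    then show "x' \<in> near_set X p d F K \<epsilon>"
      using x' z \<open>z \<in> K\<close> by (auto simp: near_set_def)
  qed
  moreover have "x \<in> X.mball x \<delta>"
    using \<open>x \<in> X\<close> \<open>\<delta> > 0\<close> by simp
  ultimately show ?thesis
    by (metis X.openin_mball interior_of_maximal subsetD)
qed

text \<open>The interiors make the intersected sets open, and the precisions 1/(n+1) make the
  intersection countable; they suffice because \<open>near_value\<close> is monotone in the
  precision.\<close>

definition near_gdelta ::
  "'a set \<Rightarrow> ('a \<Rightarrow> 'a \<Rightarrow> real) \<Rightarrow> ('b \<Rightarrow> 'b \<Rightarrow> real) \<Rightarrow> ('a \<Rightarrow> 'b set) \<Rightarrow> 'b set \<Rightarrow> 'a set" where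
  "near_gdelta X p d F K =
     (\<Inter>n. Metric_space.mtopology X p interior_of near_set X p d F K (inverse (real (Suc n))))"

lemma gdelta_in_near_gdelta: "gdelta_in (Metric_space.mtopology X p) (near_gdelta X p d F K)"
  unfolding near_gdelta_def
  by (rule gdelta_in_Inter) (auto simp del: of_nat_Suc intro: open_imp_gdelta_in)

lemma near_gdelta_subset_continuity_points:
  assumes "Metric_space Y d" "multifun X Y F"
    and compact: "\<And>x. x \<in> X \<Longrightarrow> compactin (Metric_space.mtopology Y d) (F x \<inter> K)"
  shows "near_gdelta X p d F K \<subseteq> continuity_points X p d F"
proof
  fix x assume "x \<in> near_gdelta X p d F K"
  then have near: "x \<in> near_set X p d F K (inverse (real (Suc n)))" for n
    using interior_of_subset[of _ "near_set X p d F K (inverse (real (Suc n)))"]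
    by (auto simp: near_gdelta_def)
  have "x \<in> X"
    using near by (simp add: near_set_def)
  moreover have "x \<in> near_set X p d F K \<epsilon>" if "\<epsilon> > 0" for \<epsilon>
  proof -
    obtain n where "inverse (real (Suc n)) < \<epsilon>"
      using reals_Archimedean \<open>\<epsilon> > 0\<close> by blast
    moreover obtain y where "y \<in> F x \<inter> K" "near_value X p d F (inverse (real (Suc n))) y x"
      using near[of n] unfolding near_set_def by blast
    ultimately have "near_value X p d F \<epsilon> y x"
      by (blast intro: near_value_mono less_imp_le)
    with \<open>x \<in> X\<close> \<open>y \<in> F x \<inter> K\<close> show ?thesis
      by (auto simp: near_set_def)
  qed
  ultimately show "x \<in> continuity_points X p d F"
    using multifun_cont_at_if_near_set[OF assms(1,2) compact] by (simp add: continuity_points_def)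
qed

text \<open>The radius \<open>r\<close> is independent of the precision, so one \<open>K\<close>
  serves all the interiors at once.\<close>

lemma near_gdelta_if_near_value:
  assumes "Metric_space X p" "Metric_space Y d" "multifun X Y F"
    and "x \<in> X" "y \<in> F x"
    and "\<And>\<epsilon>. \<epsilon> > 0 \<Longrightarrow> near_value X p d F \<epsilon> y x"
    and "r > 0" "Metric_space.mball Y d y r \<subseteq> K"
  shows "x \<in> near_gdelta X p d F K"
  using interior_near_set_if_near_value[OF assms] by (simp add: near_gdelta_def)

lemma Borel_Sigma_3_if_Union_gdelta:
  assumes "countable \<A>" "\<And>A. A \<in> \<A> \<Longrightarrow> gdelta_in T A"
  shows "\<Union>\<A> \<in> Borel_Sigma T 3"
proof -
  have "\<exists>k\<in>{1..Suc (Suc 0)}. \<exists>B\<in>Borel_Sigma T k. A = topspace T - B" if "A \<in> \<A>" for A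
    using assms(2)[OF that] unfolding Borel_Pi_2_iff_gdelta_in[symmetric] Borel_Pi_def
    by (intro bexI[of _ 2]) auto
  with assms(1) show ?thesis
    unfolding numeral_3_eq_3 Borel_Sigma.simps(3) by blast
qed

theorem theorem2p1:
  fixes X :: "'a set" and p :: "'a \<Rightarrow> 'a \<Rightarrow> real"
    and Y :: "'b set" and d :: "'b \<Rightarrow> 'b \<Rightarrow> real"
    and F :: "'a \<Rightarrow> 'b set"
  assumes "Metric_space X p" and "Metric_space Y d"
    and "separable_space (Metric_space.mtopology Y d)"
    and "multifun X Y F"
  shows "((\<forall>x\<in>X. compactin (Metric_space.mtopology Y d) (F x)) \<longrightarrow>
            continuity_points X p d F \<in> Borel_Pi (Metric_space.mtopology X p) 2) \<and>
         (exhaustible_by_compacts (Metric_space.mtopology Y d) \<and>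
          (\<forall>x\<in>X. closedin (Metric_space.mtopology Y d) (F x)) \<longrightarrow>
            continuity_points X p d F \<in> Borel_Sigma (Metric_space.mtopology X p) 3)"
proof (intro conjI impI)
  interpret X: Metric_space X p by fact
  interpret Y: Metric_space Y d by fact
  have F: "F x \<subseteq> Y" if "x \<in> X" for x
    using assms(4) that by (auto simp: multifun_def)
  {
    assume compact: "\<forall>x\<in>X. compactin Y.mtopology (F x)"
    \<comment> \<open>With \<open>K = Y\<close>, intersecting with \<open>K\<close> leaves
      \<open>F x\<close> unchanged, and the unit ball about any value lies in
      \<open>K\<close>.\<close>
    have "continuity_points X p d F = near_gdelta X p d F Y"
    proof
      show "near_gdelta X p d F Y \<subseteq> continuity_points X p d F"
        using compact F assms by (intro near_gdelta_subset_continuity_points) (auto simp: Int_absorb2)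
      show "continuity_points X p d F \<subseteq> near_gdelta X p d F Y"
        using near_gdelta_if_near_value[OF assms(1,2,4) _ _ _ zero_less_one Y.mball_subset_mspace]
        by (auto simp: continuity_points_def multifun_cont_at_iff_near_value)
    qed
    then show "continuity_points X p d F \<in> Borel_Pi X.mtopology 2"
      by (simp add: Borel_Pi_2_iff_gdelta_in gdelta_in_near_gdelta)
  next
    assume *: "exhaustible_by_compacts Y.mtopology \<and> (\<forall>x\<in>X. closedin Y.mtopology (F x))"
    then obtain K :: "nat \<Rightarrow> 'b set" where K: "\<And>n. compactin Y.mtopology (K n)"
      "\<And>n. K n \<subseteq> Y.mtopology interior_of K (Suc n)" "Y = (\<Union>n. K n)"
      by (auto simp: exhaustible_by_compacts_def)
    \<comment> \<open>Each \<open>F x \<inter> K n\<close> is compact, being the intersection of a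
      closed and a compact set.\<close>
    have "continuity_points X p d F = (\<Union>n. near_gdelta X p d F (K n))"
    proof
      show "(\<Union>n. near_gdelta X p d F (K n)) \<subseteq> continuity_points X p d F"
        using K * assms
        by (intro UN_least near_gdelta_subset_continuity_points) (auto intro: closed_Int_compactin)
      show "continuity_points X p d F \<subseteq> (\<Union>n. near_gdelta X p d F (K n))"
      proof
        fix x assume "x \<in> continuity_points X p d F"
        then obtain y where y: "x \<in> X" "y \<in> F x" "\<And>\<epsilon>. \<epsilon> > 0 \<Longrightarrow> near_value X p d F \<epsilon> y x"
          by (auto simp: continuity_points_def multifun_cont_at_iff_near_value)
        then obtain n where "y \<in> K n"
          using F K(3) by blast
        \<comment> \<open>The index moves up by one because \<open>y\<close> may lie on the boundary
          of \<open>K n\<close>, while a ball about it fits into \<open>K (Suc n)\<close>.\<close>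
        then have "y \<in> Y.mtopology interior_of K (Suc n)"
          using K(2) by blast
        then obtain r where "r > 0" "Y.mball y r \<subseteq> K (Suc n)"
          by (meson Y.openin_mtopology interior_of_subset openin_interior_of subset_trans)
        then have "x \<in> near_gdelta X p d F (K (Suc n))"
          using near_gdelta_if_near_value[OF assms(1,2,4) y] by blast
        then show "x \<in> (\<Union>n. near_gdelta X p d F (K n))"
          by blast
      qed
    qed
    then show "continuity_points X p d F \<in> Borel_Sigma X.mtopology 3"
      by (auto intro!: Borel_Sigma_3_if_Union_gdelta gdelta_in_near_gdelta)
  }
qed

end
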